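(* Assume that in a neighborhood of $\mu^{-1}(x)$ there is a convergent infinite product expansion $$z^{-m_x}f_{\mathfrak b}=\prod_{i=1}^\infty(1+a_iz^{m_i}t^{\ell_i})$$ with $a_i\in A$ and all $m_i\neq0$. Then the complex Ronkin function vanishes: $\mathcal R(z^{-m_x}f_{\mathfrak b},x)=0$.
   Context: Let $A$ be a finitely generated $\mathbb C$-algebra, evaluated at a point of (or in a small analytic open subset of) $\operatorname{Spec}(A)_{\mathrm{an}}$. Let $\rho$ be an $(n-1)$-dimensional integral polyhedron, $\Lambda_\rho\simeq\mathbb Z^{n-1}$ its lattice of integral tangent vectors, $X_\rho$ the associated toric variety with big torus $\operatorname{Spec}\mathbb C[\Lambda_\rho]\simeq(\mathbb C^* )^{n-1}$, and $\mu:X_\rho\to\rho$ a momentum map (so that for $x\in\operatorname{Int}\rho$, $\mu^{-1}(x)\simeq\operatorname{Hom}(\Lambda_\rho,U(1))\simeq U(1)^{n-1}$ is a torus orbit). Let $\mathfrak b\subseteq\rho$ be a slab (an $(n-1)$-dimensional rational polyhedron contained in $\rho$) with slab function $f_{\mathfrak b}\in A[\Lambda_\rho][t]$, and let $x\in\operatorname{Int}\mathfrak b$ be a point not in the amoeba image, i.e. the reduction of $f_{\mathfrak b}$ modulo $t$ has no zeros on $\mu^{-1}(x)$. Then $m_x\in\Lambda_\rho$ is the unique element such that $z^{-m_x}f_{\mathfrak b}$ (modulo $t$) is contractible as a map $\mu^{-1}(x)\to\mathbb C^*$. With toric coordinates $z_1,\dots,z_{n-1}$ on $\operatorname{Spec}\mathbb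 C[\Lambda_\rho]$, the complex Ronkin function is $$\mathcal R(z^{-m_x}f_{\mathfrak b},x)=\frac1{(2\pi\sqrt{-1})^{n-1}}\int_{\mu^{-1}(x)}\frac{\log\big(z^{-m_x}f_{\mathfrak b}(z_1,\dots,z_{n-1})\big)}{z_1\cdots z_{n-1}}\,dz_1\cdots dz_{n-1},$$ a power series in $t$ (the logarithm is expanded in $t$). In the product, $m_i\in\Lambda_\rho$ and $\ell_i\in\mathbb N$; convergence is such that $\log(z^{-m_x}f_{\mathfrak b})$ is represented near $\mu^{-1}(x)$ by the convergent Laurent expansion $\sum_i\log(1+a_iz^{m_i}t^{\ell_i})=\sum_i\sum_{j>0}\frac{(-1)^{j-1}}ja_i^jz^{jm_i}t^{j\ell_i}$. *)

theory Defs
  imports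
    "HOL-Complex_Analysis.Complex_Analysis"
    "HOL-Computational_Algebra.Computational_Algebra"
    "HOL-Library.Poly_Mapping"
begin

text \<open>
  Toric coordinates identify the lattice \<open>\<Lambda>\<^sub>\<rho>\<close> with \<^typ>\<open>int ^ 'k\<close>, where \<open>'k\<close> is a finite index
  type with \<open>n - 1\<close> elements. The big torus then consists of the vectors in \<^typ>\<open>complex ^ 'k\<close>
  without zero coordinate, and \<open>A[\<Lambda>\<^sub>\<rho>][t]\<close> is the type \<open>((int ^ 'k) \<Rightarrow>\<^sub>0 'a) poly\<close>.
\<close>

section \<open>The coefficient algebra\<close>

definition is_ring_hom :: "('a::comm_ring_1 \<Rightarrow> 'b::comm_ring_1) \<Rightarrow> bool" where
  "is_ring_hom h \<longleftrightarrow> h 1 = 1 \<and> (\<forall>a b. h (a + b) = h a + h b) \<and> (\<forall>a b. h (a * b) = h a * h b)"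

definition finitely_generated_algebra :: "(complex \<Rightarrow> 'a::comm_ring_1) \<Rightarrow> bool" where
  "finitely_generated_algebra \<iota> \<longleftrightarrow> is_ring_hom \<iota> \<and>
     (\<exists>G. finite G \<and>
        (\<forall>B. range \<iota> \<subseteq> B \<and> G \<subseteq> B \<and> (\<forall>a\<in>B. \<forall>b\<in>B. a + b \<in> B \<and> a * b \<in> B) \<longrightarrow> B = UNIV))"

text \<open>The points of \<open>Spec(A)\<^sub>a\<^sub>n\<close> are the homomorphisms of complex algebras from \<open>A\<close> to the
  complex numbers.\<close>

definition analytic_point :: "(complex \<Rightarrow> 'a::comm_ring_1) \<Rightarrow> ('a \<Rightarrow> complex) \<Rightarrow> bool" where
  "analytic_point \<iota> ev \<longleftrightarrow> is_ring_hom ev \<and> (\<forall>c. ev (\<iota> c) = c)"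

section \<open>Polyhedra\<close>

definition real_vec :: "int ^ 'k \<Rightarrow> real ^ 'k" where
  "real_vec m = (\<chi> k. of_int (m $ k))"

definition rational_polyhedron :: "(real ^ 'k) set \<Rightarrow> bool" where
  "rational_polyhedron P \<longleftrightarrow>
     (\<exists>H :: ((real ^ 'k) \<times> real) set. finite H \<and>
        (\<forall>(v, c)\<in>H. (\<forall>k. v $ k \<in> \<rat>) \<and> c \<in> \<rat>) \<and>
        P = {y. \<forall>(v, c)\<in>H. v \<bullet> y \<le> c})"

text \<open>If \<open>P\<close> has a vertex, the condition on faces says that all vertices of \<open>P\<close> are integral.\<close>

definition integral_polyhedron :: "(real ^ 'k) set \<Rightarrow> bool" where
  "integral_polyhedron P \<longleftrightarrow> rational_polyhedron P \<and> P \<noteq> {} \<and>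
     (\<forall>F. F face_of P \<and> F \<noteq> {} \<longrightarrow> (\<exists>m. real_vec m \<in> F))"

section \<open>The toric variety and its momentum map\<close>

definition big_torus :: "(complex ^ 'k) set" where
  "big_torus = {z. \<forall>k. z $ k \<noteq> 0}"

definition monomial :: "complex ^ 'k \<Rightarrow> int ^ 'k \<Rightarrow> complex" where
  "monomial z m = (\<Prod>k\<in>UNIV. (z $ k) powi (m $ k))"

text \<open>The integral points \<open>(m, h)\<close> of the closure of the cone over \<open>\<rho> \<times> {1}\<close>. At height 0 this
  is the recession cone of \<open>\<rho>\<close>.\<close>

definition cone_points :: "(real ^ 'k) set \<Rightarrow> ((int ^ 'k) \<times> nat) set" where
  "cone_points \<rho> =
     {(m, h). if h = 0 then (\<forall>y\<in>\<rho>. y + real_vec m \<in> \<rho>)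
              else (1 / real h) *\<^sub>R real_vec m \<in> \<rho>}"

text \<open>
  \<open>X\<^sub>\<rho> = Proj \<complex>[cone_points \<rho>]\<close>, graded by \<open>h\<close>. A closed point of \<open>X\<^sub>\<rho>\<close> is represented by
  homogeneous coordinates: a homomorphism \<open>\<phi>\<close> of monoids from \<open>cone_points \<rho>\<close> to the multiplicative
  monoid of complex numbers (extended by 0 outside the cone), not vanishing in all positive
  degrees. It is unique up to rescaling by \<open>c\<^sup>h\<close>. Points of the big torus are
  those of the form \<open>(m, h) \<mapsto> c\<^sup>h z\<^sup>m\<close>.
\<close>

definition homogeneous_points :: "(real ^ 'k) set \<Rightarrow> ((int ^ 'k) \<times> nat \<Rightarrow> complex) set" where
  "homogeneous_points \<rho> = {\<phi>. (\<forall>s. s \<notin> cone_points \<rho> \<longrightarrow> \<phi> s = 0) \<and> \<phi> (0, 0) = 1 \<and>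
     (\<forall>(m, h)\<in>cone_points \<rho>. \<forall>(m', h')\<in>cone_points \<rho>.
        \<phi> (m + m', h + h') = \<phi> (m, h) * \<phi> (m', h')) \<and>
     (\<exists>(m, h)\<in>cone_points \<rho>. h > 0 \<and> \<phi> (m, h) \<noteq> 0)}"

definition torus_point :: "(real ^ 'k) set \<Rightarrow> complex ^ 'k \<Rightarrow> (int ^ 'k) \<times> nat \<Rightarrow> complex" where
  "torus_point \<rho> z = (\<lambda>(m, h). if (m, h) \<in> cone_points \<rho> then monomial z m else 0)"

text \<open>The action of the torus on homogeneous coordinates, combined with rescaling by \<open>c\<close>.\<close>

definition torus_act ::
    "complex \<Rightarrow> complex ^ 'k \<Rightarrow> ((int ^ 'k) \<times> nat \<Rightarrow> complex) \<Rightarrow> (int ^ 'k) \<times> nat \<Rightarrow> complex" where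
  "torus_act c z \<phi> = (\<lambda>(m, h). c ^ h * monomial z m * \<phi> (m, h))"

text \<open>
  The properties shared by all momentum maps \<open>X\<^sub>\<rho> \<rightarrow> \<rho>\<close>: a continuous surjection whose fibres are
  the orbits of the compact torus \<open>U(1)\<^sup>n\<^sup>-\<^sup>1\<close>, with the big torus lying over the interior.
  The case \<open>u = 1\<close> of the fibre condition says that \<open>\<mu>\<close> does not depend on the choice of
  homogeneous coordinates.
\<close>

definition momentum_map ::
    "(real ^ 'k) set \<Rightarrow> (((int ^ 'k) \<times> nat \<Rightarrow> complex) \<Rightarrow> real ^ 'k) \<Rightarrow> bool" where
  "momentum_map \<rho> \<mu> \<longleftrightarrow>
     continuous_on (homogeneous_points \<rho>) \<mu> \<and>
     \<mu> ` homogeneous_points \<rho> = \<rho> \<and>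
     (\<forall>\<phi>\<in>homogeneous_points \<rho>. \<forall>\<psi>\<in>homogeneous_points \<rho>.
        \<mu> \<phi> = \<mu> \<psi> \<longleftrightarrow> (\<exists>c u. c \<noteq> 0 \<and> (\<forall>k. cmod (u $ k) = 1) \<and> \<psi> = torus_act c u \<phi>)) \<and>
     (\<forall>\<phi>\<in>homogeneous_points \<rho>.
        \<mu> \<phi> \<in> interior \<rho> \<longleftrightarrow>
          (\<exists>c z. c \<noteq> 0 \<and> z \<in> big_torus \<and> \<phi> = torus_act c z (torus_point \<rho> 1)))"

text \<open>For \<open>x\<close> in the interior of \<open>\<rho>\<close> the whole fibre \<open>\<mu>\<^sup>-\<^sup>1(x)\<close> lies in the big torus; this is the
  fibre written in toric coordinates.\<close>

definition momentum_fibre ::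
    "(real ^ 'k) set \<Rightarrow> (((int ^ 'k) \<times> nat \<Rightarrow> complex) \<Rightarrow> real ^ 'k) \<Rightarrow> real ^ 'k \<Rightarrow>
     (complex ^ 'k) set" where
  "momentum_fibre \<rho> \<mu> x = {z \<in> big_torus. \<mu> (torus_point \<rho> z) = x}"

section \<open>Slab functions\<close>

definition laurent_eval ::
    "('a::comm_ring_1 \<Rightarrow> complex) \<Rightarrow> ((int ^ 'k) \<Rightarrow>\<^sub>0 'a) \<Rightarrow> complex ^ 'k \<Rightarrow> complex" where
  "laurent_eval ev p z = (\<Sum>m\<in>Poly_Mapping.keys p. ev (Poly_Mapping.lookup p m) * monomial z m)"

text \<open>The function \<open>z\<^sup>-\<^sup>m f\<close> at the point \<open>ev\<close> of \<open>Spec(A)\<^sub>a\<^sub>n\<close>, as a function of \<open>z\<close> with values in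
  formal power series in \<open>t\<close>.\<close>

definition twisted_slab_function ::
    "('a::comm_ring_1 \<Rightarrow> complex) \<Rightarrow> ((int ^ 'k) \<Rightarrow>\<^sub>0 'a) poly \<Rightarrow> int ^ 'k \<Rightarrow>
     complex ^ 'k \<Rightarrow> complex fps" where
  "twisted_slab_function ev f m z =
     fps_const (monomial z (- m)) * Abs_fps (\<lambda>l. laurent_eval ev (poly.coeff f l) z)"

definition contractible_map :: "('b::topological_space) set \<Rightarrow> ('b \<Rightarrow> complex) \<Rightarrow> bool" where
  "contractible_map T g \<longleftrightarrow> (\<exists>c. homotopic_with_canon (\<lambda>_. True) T (- {0}) g (\<lambda>_. c))"

text \<open>The element \<open>m\<^sub>x\<close> of the lattice, for \<open>T = \<mu>\<^sup>-\<^sup>1(x)\<close>.\<close>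

definition slab_order ::
    "('a::comm_ring_1 \<Rightarrow> complex) \<Rightarrow> ((int ^ 'k) \<Rightarrow>\<^sub>0 'a) poly \<Rightarrow> (complex ^ 'k) set \<Rightarrow> int ^ 'k" where
  "slab_order ev f T =
     (THE m. contractible_map T (\<lambda>z. fps_nth (twisted_slab_function ev f m z) 0))"

section \<open>The complex Ronkin function\<close>

text \<open>
  The integral of \<open>F dz\<^sub>1 \<dots> dz\<^sub>n\<^sub>-\<^sub>1\<close> over the torus \<open>T = {z. |z\<^sub>k| = r\<^sub>k}\<close>, parametrised by the product
  of the standard circle paths.
\<close>

definition torus_radii :: "(complex ^ 'k) set \<Rightarrow> real ^ 'k" where
  "torus_radii T = (THE r. (\<forall>k. r $ k > 0) \<and> T = {z. \<forall>k. cmod (z $ k) = r $ k})"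

definition torus_integral :: "(complex ^ 'k) set \<Rightarrow> (complex ^ 'k \<Rightarrow> complex) \<Rightarrow> complex" where
  "torus_integral T F = integral (cbox 0 1) (\<lambda>\<theta>.
     F (\<chi> k. circlepath 0 (torus_radii T $ k) (\<theta> $ k)) *
     (\<Prod>k\<in>UNIV. vector_derivative (circlepath 0 (torus_radii T $ k)) (at (\<theta> $ k))))"

text \<open>
  The logarithm of a power series \<open>g = g\<^sub>0 + g\<^sub>1 t + \<dots>\<close> with \<open>g\<^sub>0 \<noteq> 0\<close>, expanded in \<open>t\<close> as
  \<open>c + log (1 + (g\<^sub>1 t + g\<^sub>2 t\<^sup>2 + \<dots>) / g\<^sub>0)\<close>, where \<open>c\<close> is the chosen logarithm of \<open>g\<^sub>0\<close>.
\<close>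

definition log_series :: "complex \<Rightarrow> complex fps \<Rightarrow> complex fps" where
  "log_series c g =
     fps_const c + fps_compose (fps_ln 1) (fps_const (inverse (fps_nth g 0)) * g - 1)"

text \<open>The function \<open>lg\<close> is a continuous branch on \<open>U\<close> of the logarithm of \<open>g\<close> modulo \<open>t\<close>.\<close>

definition log_branch ::
    "(complex ^ 'k) set \<Rightarrow> (complex ^ 'k \<Rightarrow> complex fps) \<Rightarrow> (complex ^ 'k \<Rightarrow> complex) \<Rightarrow> bool" where
  "log_branch U g lg \<longleftrightarrow> continuous_on U lg \<and> (\<forall>z\<in>U. exp (lg z) = fps_nth (g z) 0)"

text \<open>
  The Ronkin function of \<open>g\<close> over the torus \<open>T\<close>. The branch \<open>lg\<close> is an argument, since changing it
  by \<open>2\<pi>\<i>\<close> changes the constant coefficient of the integral by \<open>2\<pi>\<i>\<close>.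
\<close>

definition complex_ronkin ::
    "(complex ^ 'k) set \<Rightarrow> (complex ^ 'k \<Rightarrow> complex fps) \<Rightarrow> (complex ^ 'k \<Rightarrow> complex) \<Rightarrow>
     complex fps" where
  "complex_ronkin T g lg = Abs_fps (\<lambda>l.
     1 / (2 * of_real pi * \<i>) ^ CARD('k) *
     torus_integral T (\<lambda>z. fps_nth (log_series (lg z) (g z)) l / (\<Prod>k\<in>UNIV. z $ k)))"

section \<open>Infinite product expansions\<close>

text \<open>
  Convergence of sequences of power series in \<open>t\<close> with coefficients functions on \<open>U\<close>: each
  coefficient converges uniformly on compact subsets of \<open>U\<close>.
\<close>

definition locally_uniform_limit ::
    "(complex ^ 'k) set \<Rightarrow> (nat \<Rightarrow> complex ^ 'k \<Rightarrow> complex fps) \<Rightarrow>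
     (complex ^ 'k \<Rightarrow> complex fps) \<Rightarrow> bool" where
  "locally_uniform_limit U G g \<longleftrightarrow>
     (\<forall>K l. compact K \<and> K \<subseteq> U \<longrightarrow>
        uniform_limit K (\<lambda>N z. fps_nth (G N z) l) (\<lambda>z. fps_nth (g z) l) sequentially)"

definition product_factor :: "complex \<Rightarrow> nat \<Rightarrow> complex fps" where
  "product_factor w d = 1 + fps_const w * fps_X ^ d"

text \<open>The expansion \<open>\<Sum>\<^sub>j\<^sub>>\<^sub>0 (-1)\<^sup>j\<^sup>-\<^sup>1/j w\<^sup>j t\<^sup>j\<^sup>d\<close> of \<open>log (1 + w t\<^sup>d)\<close>, sorted by powers of \<open>t\<close>. For \<open>d = 0\<close>
  all terms have degree 0 in \<open>t\<close>, so that convergence is an issue.\<close>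

definition log_term :: "complex \<Rightarrow> nat \<Rightarrow> complex" where
  "log_term w j = (- 1) ^ (j - 1) / of_nat j * w ^ j"

definition log_factor :: "complex \<Rightarrow> nat \<Rightarrow> complex fps" where
  "log_factor w d = Abs_fps (\<lambda>l. \<Sum>\<^sub>\<infinity>j\<in>{j. j > 0 \<and> j * d = l}. log_term w j)"

definition log_factor_converges :: "complex \<Rightarrow> nat \<Rightarrow> bool" where
  "log_factor_converges w d \<longleftrightarrow> (\<forall>l. log_term w summable_on {j. j > 0 \<and> j * d = l})"

text \<open>
  On \<open>U\<close> the product of the factors \<open>1 + w\<^sub>i(z) t\<^bsup>d\<^sub>i\<^esup>\<close>, \<open>i \<ge> 1\<close>, converges to \<open>g\<close>, and the logarithm of
  \<open>g\<close> is represented by the convergent expansion of the sum of the logarithms of the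
  factors. The latter determines the branch \<open>lg\<close>.
\<close>

definition convergent_product_expansion ::
    "(complex ^ 'k) set \<Rightarrow> (complex ^ 'k \<Rightarrow> complex fps) \<Rightarrow> (complex ^ 'k \<Rightarrow> complex) \<Rightarrow>
     (nat \<Rightarrow> complex ^ 'k \<Rightarrow> complex) \<Rightarrow> (nat \<Rightarrow> nat) \<Rightarrow> bool" where
  "convergent_product_expansion U g lg w d \<longleftrightarrow>
     locally_uniform_limit U (\<lambda>N z. \<Prod>i=1..N. product_factor (w i z) (d i)) g \<and>
     log_branch U g lg \<and>
     (\<forall>i\<ge>1. \<forall>z\<in>U. log_factor_converges (w i z) (d i)) \<and>
     locally_uniform_limit U (\<lambda>N z. \<Sum>i=1..N. log_factor (w i z) (d i))
       (\<lambda>z. log_series (lg z) (g z))"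

end

theory Submission
  imports Defs
begin

text \<open>
  In the coordinates \<open>z\<^sub>k = r\<^sub>k exp (2\<pi>\<i>\<theta>\<^sub>k)\<close> the form \<open>dz\<^sub>1 \<dots> dz\<^sub>n\<^sub>-\<^sub>1 / (z\<^sub>1 \<dots> z\<^sub>n\<^sub>-\<^sub>1)\<close> is a constant
  multiple of \<open>d\<theta>\<^sub>1 \<dots> d\<theta>\<^sub>n\<^sub>-\<^sub>1\<close>. So each coefficient in \<open>t\<close> of the Ronkin function is the mean value,
  over a compact torus, of the corresponding coefficient of the logarithm. A nontrivial monomial
  \<open>z\<^sup>m\<close> has mean value zero, being a nontrivial character of that torus
  (\<open>mean_zero_monomial\<close>). The expansion of the logarithm of the product contains only multiples of
  the monomials \<open>z\<^bsup>j m\<^sub>i\<^esup>\<close> with \<open>j > 0\<close> and \<open>m\<^sub>i \<noteq> 0\<close>, hence no constant term. It remains to integrate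
  it term by term.

  Two interchanges of sum and integral are involved. The sum over the factors converges uniformly
  on compact sets, by the meaning of a convergent expansion. The sum over \<open>j\<close> inside a factor is
  only assumed to converge pointwise, and is infinite for factors of degree 0 in \<open>t\<close>. Its terms
  however have constant absolute value on the torus, so that absolute convergence at one point
  gives uniform convergence (\<open>mean_zero_log_factor\<close>).

  That the fibre of the momentum map over \<open>x\<close> is a torus \<open>{z. |z\<^sub>k| = r\<^sub>k}\<close> has to be extracted from
  the description of the fibres in homogeneous coordinates, where the orbit of the compact torus
  appears only up to rescaling by \<open>c\<^sup>h\<close> (\<open>momentum_fibre_torus\<close>). If two points of the big torus
  lie in one fibre, the logarithms of the absolute values of their coordinates differ by a
  vector whose inner product with the rational points of \<open>\<rho>\<close> is constant. As \<open>\<rho>\<close> has interior points,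
  this vector is zero (\<open>cone_points_separate\<close>).
\<close>

section \<open>Integrals of products over the unit cube\<close>

text \<open>Lebesgue measure on a Euclidean space is the image of the product measure over the
  coordinates, so that this is the theorem of Fubini for products of functions of one coordinate.\<close>

lemma lborel_prod_coordinates:
  fixes g :: "'b::euclidean_space \<Rightarrow> real \<Rightarrow> complex"
  assumes g: "\<And>b. b \<in> Basis \<Longrightarrow> integrable lborel (g b)"
  shows "integrable lborel (\<lambda>y. \<Prod>b\<in>Basis. g b (y \<bullet> b))"
    and "integral\<^sup>L lborel (\<lambda>y. \<Prod>b\<in>Basis. g b (y \<bullet> b)) = (\<Prod>b\<in>Basis. integral\<^sup>L lborel (g b))"
proof -
  interpret product_sigma_finite "\<lambda>_::'b. lborel :: real measure" ..
  note [measurable] = borel_measurable_integrable[OF g, simplified]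
  have coords: "(\<Prod>b\<in>Basis. g b ((\<Sum>c\<in>Basis. h c *\<^sub>R c) \<bullet> b)) = (\<Prod>b\<in>Basis. g b (h b))" for h :: "'b \<Rightarrow> real"
    by (intro prod.cong) simp_all
  have meas: "(\<lambda>y. \<Prod>b\<in>Basis. g b (y \<bullet> b)) \<in> borel_measurable (borel :: 'b measure)"
    by measurable
  have sum_meas: "(\<lambda>h. \<Sum>b\<in>Basis. h b *\<^sub>R b) \<in> measurable (\<Pi>\<^sub>M b\<in>Basis. lborel) (borel :: 'b measure)"
    by measurable
  show "integrable lborel (\<lambda>y. \<Prod>b\<in>Basis. g b (y \<bullet> b))"
    by (subst lborel_eq, subst integrable_distr_eq[OF sum_meas meas],
        simp only: coords, rule product_integrable_prod) (use g in auto)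
  show "integral\<^sup>L lborel (\<lambda>y. \<Prod>b\<in>Basis. g b (y \<bullet> b)) = (\<Prod>b\<in>Basis. integral\<^sup>L lborel (g b))"
    by (subst lborel_eq, subst integral_distr[OF sum_meas meas],
        simp only: coords, rule product_integral_prod) (use g in auto)
qed

lemma has_integral_prod_coordinates:
  fixes h :: "'k::finite \<Rightarrow> real \<Rightarrow> complex"
  assumes h: "\<And>k. continuous_on {0..1} (h k)"
  shows "((\<lambda>\<theta>. \<Prod>k\<in>UNIV. h k (\<theta> $ k)) has_integral (\<Prod>k\<in>UNIV. integral {0..1} (h k)))
    (cbox 0 (1 :: real ^ 'k))"
proof -
  \<comment> \<open>Extended by 0 outside \<open>{0..1}\<close>, the factors multiply to an extension by 0 outside the cube;
    the index of a basis vector \<open>axis k 1\<close> is recovered by \<open>THE\<close>.\<close>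
  define g where "g b = (\<lambda>t. indicator {0..1} t *\<^sub>R h (THE k. b = axis k (1::real)) t)" for b
  have g_axis: "g (axis k 1) = (\<lambda>t. indicator {0..1} t *\<^sub>R h k t)" for k
    by (simp add: g_def axis_eq_axis)
  have int_h: "integrable lborel (\<lambda>t. indicator {0..1} t *\<^sub>R h k t)" for k
    using borel_integrable_compact[OF compact_Icc h[of k]] by simp
  have bas: "(Basis :: (real ^ 'k) set) = range (\<lambda>k. axis k 1)"
    by (auto simp: Basis_vec_def)
  have inj: "inj (\<lambda>k::'k. axis k (1::real))"
    by (auto simp: inj_on_def axis_eq_axis)
  have prodB: "(\<Prod>b\<in>Basis. G b) = (\<Prod>k\<in>UNIV. G (axis k 1))" for G :: "real ^ 'k \<Rightarrow> complex"
    unfolding bas by (subst prod.reindex[OF inj]) simp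
  have gB: "integrable lborel (g b)" if "b \<in> Basis" for b
    using that int_h by (auto simp: bas g_axis)
  have ind: "(\<Prod>b\<in>Basis. g b (\<theta> \<bullet> b)) = indicator (cbox 0 1) \<theta> *\<^sub>R (\<Prod>k\<in>UNIV. h k (\<theta> $ k))" for \<theta> :: "real ^ 'k"
  proof (cases "\<theta> \<in> cbox 0 1")
    case True
    then show ?thesis
      by (simp add: prodB g_axis inner_axis mem_box_cart)
  next
    case False
    then obtain k where "\<theta> $ k \<notin> {0..1}"
      by (auto simp: mem_box_cart)
    then have "(\<Prod>k\<in>UNIV. indicator {0..1} (\<theta> $ k) *\<^sub>R h k (\<theta> $ k)) = 0"
      by (intro prod_zero bexI[of _ k]) (auto simp: indicator_def)
    with False show ?thesis
      by (simp add: prodB g_axis inner_axis)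
  qed
  note L = lborel_prod_coordinates[of g, OF gB, simplified]
  have 1: "((\<lambda>\<theta>. indicator (cbox 0 1) \<theta> *\<^sub>R (\<Prod>k\<in>UNIV. h k (\<theta> $ k))) has_integral
      (\<Prod>k\<in>UNIV. integral\<^sup>L lborel (\<lambda>t. indicator {0..1} t *\<^sub>R h k t))) (UNIV :: (real ^ 'k) set)"
    using has_integral_integral_lborel[OF L(1)] L(2)
    by (simp add: ind prodB[of "\<lambda>b. integral\<^sup>L lborel (g b)"] g_axis)
  have 2: "integral\<^sup>L lborel (\<lambda>t. indicator {0..1} t *\<^sub>R h k t) = integral {0..1} (h k)" for k
    using set_borel_integral_eq_integral(2)[of "{0..1}" "h k"] int_h[of k]
    by (simp add: set_integrable_def set_lebesgue_integral_def)
  have "((\<lambda>\<theta>. if \<theta> \<in> cbox 0 1 then \<Prod>k\<in>UNIV. h k (\<theta> $ k) else 0) has_integral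
      (\<Prod>k\<in>UNIV. integral {0..1} (h k))) (UNIV :: (real ^ 'k) set)"
    by (rule has_integral_eq[OF _ 1[unfolded 2]]) simp
  then show ?thesis
    by (simp only: has_integral_restrict_UNIV)
qed

lemma integral_exp_character:
  assumes "n \<noteq> (0::int)"
  shows "integral {0..1} (\<lambda>t. exp (of_int n * (2 * of_real pi * \<i> * of_real t))) = (0::complex)"
proof -
  define c where "c = of_int n * (2 * complex_of_real pi * \<i>)"
  have c: "c \<noteq> 0" using assms by (simp add: c_def)
  have e: "exp c = 1"
    using exp_integer_2pi[of "of_int n"] by (simp add: c_def mult_ac)
  have "((\<lambda>t. exp (c * of_real t)) has_integral (exp (c * of_real 1) / c - exp (c * of_real 0) / c)) {0..1}"
    by (rule fundamental_theorem_of_calculus)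
       (use c in \<open>auto intro!: derivative_eq_intros has_vector_derivative_real_field\<close>)
  then have "((\<lambda>t. exp (c * of_real t)) has_integral 0) {0..1}"
    using e by simp
  then show ?thesis
    unfolding c_def mult.assoc by (rule integral_unique)
qed

section \<open>Monomials and compact tori\<close>

lemma monomial_nonzero: "z \<in> big_torus \<Longrightarrow> monomial z m \<noteq> 0"
  by (simp add: monomial_def big_torus_def)

lemma monomial_add: "z \<in> big_torus \<Longrightarrow> monomial z (m + m') = monomial z m * monomial z m'"
  by (simp add: monomial_def big_torus_def power_int_add prod.distrib)

lemma monomial_0: "monomial z 0 = 1"
  by (simp add: monomial_def)

lemma monomial_1: "monomial 1 m = 1"
  by (simp add: monomial_def)

lemma norm_monomial: "norm (monomial z m) = (\<Prod>k\<in>UNIV. norm (z $ k) powi (m $ k))"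
  by (simp add: monomial_def prod_norm[symmetric] norm_power_int)

lemma monomial_power: "monomial z m ^ j = monomial z (\<chi> k. int j * m $ k)"
proof -
  have "(c powi n) ^ j = c powi (int j * n)" for c :: complex and n
    by (metis mult.commute power_int_mult power_int_of_nat)
  then show ?thesis
    by (simp add: monomial_def prod_power_distrib)
qed

lemma continuous_on_monomial:
  assumes "A \<subseteq> big_torus" shows "continuous_on A (\<lambda>z. monomial z m)"
  unfolding monomial_def
  using assms by (intro continuous_intros) (auto simp: big_torus_def)

definition torus :: "real ^ 'k \<Rightarrow> (complex ^ 'k) set" where
  "torus r = {z. \<forall>k. cmod (z $ k) = r $ k}"

definition polar_point :: "real ^ 'k \<Rightarrow> real ^ 'k \<Rightarrow> complex ^ 'k" where
  "polar_point r \<theta> = (\<chi> k. circlepath 0 (r $ k) (\<theta> $ k))"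

lemma polar_point_in_torus:
  fixes r :: "real ^ 'k"
  shows "(\<And>k. r $ k > 0) \<Longrightarrow> polar_point r \<theta> \<in> torus r"
  by (auto simp: torus_def polar_point_def circlepath norm_mult less_imp_le)

lemma continuous_polar_point: "continuous_on A (polar_point r)"
  unfolding polar_point_def circlepath by (intro continuous_intros)

lemma torus_subset_big_torus:
  fixes r :: "real ^ 'k"
  shows "(\<And>k. r $ k > 0) \<Longrightarrow> torus r \<subseteq> big_torus"
  unfolding torus_def big_torus_def using less_irrefl by (smt (verit) mem_Collect_eq norm_zero subsetI)

lemma compact_torus:
  fixes r :: "real ^ 'k"
  shows "compact (torus r)"
  unfolding compact_eq_bounded_closed
proof
  have "norm z \<le> (\<Sum>k\<in>UNIV. r $ k)" if "z \<in> torus r" for z :: "complex ^ 'k"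
  proof -
    have "norm z \<le> (\<Sum>k\<in>UNIV. cmod (z $ k))"
      unfolding norm_vec_def by (rule L2_set_le_sum) simp
    with that show ?thesis
      by (simp add: torus_def)
  qed
  then show "bounded (torus r)"
    by (auto simp: bounded_iff)
  show "closed (torus r)"
    unfolding torus_def by (intro closed_Collect_all closed_Collect_eq continuous_intros)
qed

section \<open>Functions of mean zero on a compact torus\<close>

text \<open>The mean value is taken with respect to the invariant measure of the torus. Continuity is part of
  the notion to make it stable under uniform limits, as it guarantees integrability.\<close>

definition mean_zero :: "real ^ 'k \<Rightarrow> (complex ^ 'k \<Rightarrow> complex) \<Rightarrow> bool" where
  "mean_zero r F \<longleftrightarrow> continuous_on (torus r) F \<and>
     ((\<lambda>\<theta>. F (polar_point r \<theta>)) has_integral 0) (cbox 0 1)"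

lemma mean_zero_0: "mean_zero r (\<lambda>_. 0)"
  by (simp add: mean_zero_def)

lemma mean_zero_cmult: "mean_zero r F \<Longrightarrow> mean_zero r (\<lambda>z. c * F z)"
  using has_integral_mult_right[of "\<lambda>\<theta>. F (polar_point r \<theta>)" 0 "cbox 0 1" c]
  by (auto simp: mean_zero_def intro!: continuous_intros)

lemma mean_zero_sum:
  assumes "\<And>i. i \<in> I \<Longrightarrow> mean_zero r (F i)"
  shows "mean_zero r (\<lambda>z. \<Sum>i\<in>I. F i z)"
proof (cases "finite I")
  case True
  then show ?thesis
    using has_integral_sum[of I "\<lambda>i \<theta>. F i (polar_point r \<theta>)" "\<lambda>_. 0" "cbox 0 1"] assms
    by (auto simp: mean_zero_def intro!: continuous_intros)
qed (simp add: mean_zero_0)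

lemma mean_zero_uniform_limit:
  fixes r :: "real ^ 'k"
  assumes r: "\<And>k. r $ k > 0" and F: "\<And>n. mean_zero r (F n)"
    and lim: "uniform_limit (torus r) F G X" and "X \<noteq> bot"
  shows "mean_zero r G"
proof -
  have "uniform_limit (cbox 0 1) (\<lambda>n \<theta>. F n (polar_point r \<theta>)) (\<lambda>\<theta>. G (polar_point r \<theta>)) X"
    by (rule uniform_limit_compose'[OF lim]) (auto intro: polar_point_in_torus r)
  moreover have "continuous_on (cbox 0 1) (\<lambda>\<theta>. F n (polar_point r \<theta>))" for n
    by (rule continuous_on_compose2[of "torus r" "F n"])
       (use F in \<open>auto simp: mean_zero_def intro: polar_point_in_torus r continuous_polar_point\<close>)
  ultimately obtain I J where IJ: "\<And>n. ((\<lambda>\<theta>. F n (polar_point r \<theta>)) has_integral I n) (cbox 0 1)"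
      "((\<lambda>\<theta>. G (polar_point r \<theta>)) has_integral J) (cbox 0 1)" "(I \<longlongrightarrow> J) X"
    using uniform_limit_integral_cbox[OF _ _ \<open>X \<noteq> bot\<close>] by metis
  have "I n = 0" for n
    using has_integral_unique[OF IJ(1)] F by (simp add: mean_zero_def)
  then have "I = (\<lambda>_. 0)" ..
  with IJ(3) \<open>X \<noteq> bot\<close> have "J = 0"
    by (simp add: tendsto_const_iff)
  moreover have "continuous_on (torus r) G"
    by (rule uniform_limit_theorem[OF _ lim \<open>X \<noteq> bot\<close>]) (use F in \<open>auto simp: mean_zero_def\<close>)
  ultimately show ?thesis
    using IJ(2) by (simp add: mean_zero_def)
qed

text \<open>The mean value factors into integrals over circles, and a coordinate with nonzero exponent
  contributes the integral of \<open>exp (2\<pi>\<i>nt)\<close> over full periods.\<close>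

lemma mean_zero_monomial:
  fixes r :: "real ^ 'k"
  assumes r: "\<And>k. r $ k > 0" and m: "m \<noteq> 0"
  shows "mean_zero r (\<lambda>z. monomial z m)"
proof -
  obtain k0 where k0: "m $ k0 \<noteq> 0"
    using m by (auto simp: vec_eq_iff)
  define h where "h k = (\<lambda>t. of_real (r $ k) powi (m $ k) *
      exp (of_int (m $ k) * (2 * of_real pi * \<i> * complex_of_real t)))" for k
  have "monomial (polar_point r \<theta>) m = (\<Prod>k\<in>UNIV. h k (\<theta> $ k))" for \<theta>
    unfolding monomial_def polar_point_def h_def
    by (intro prod.cong) (simp_all add: circlepath power_int_mult_distrib exp_power_int)
  moreover have "((\<lambda>\<theta>. \<Prod>k\<in>UNIV. h k (\<theta> $ k)) has_integral (\<Prod>k\<in>UNIV. integral {0..1} (h k))) (cbox 0 1)"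
    by (rule has_integral_prod_coordinates) (auto simp: h_def intro!: continuous_intros)
  moreover have "integral {0..1} (h k0) = 0"
    using integral_exp_character[OF k0] by (simp add: h_def)
  then have "(\<Prod>k\<in>UNIV. integral {0..1} (h k)) = 0"
    by (intro prod_zero) auto
  ultimately show ?thesis
    using continuous_on_monomial[OF torus_subset_big_torus[OF r]] by (simp add: mean_zero_def)
qed

section \<open>The Ronkin function of a product expansion\<close>

text \<open>The coefficient is a sum of multiples of \<open>z\<^bsup>j m\<^esup>\<close> over all \<open>j > 0\<close> with \<open>j d = l\<close>, none of which is
  constant. For \<open>d = l = 0\<close> these are all \<open>j > 0\<close>. Since \<open>|\<alpha> z\<^sup>m|\<close> is constant on the torus, the
  absolute values of the terms at a single point serve as majorants in the M-test of
  Weierstrass.\<close>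

lemma mean_zero_log_factor:
  fixes r :: "real ^ 'k"
  assumes r: "\<And>k. r $ k > 0" and m: "m \<noteq> 0"
    and conv: "\<And>z. z \<in> torus r \<Longrightarrow> log_factor_converges (\<alpha> * monomial z m) d"
  shows "mean_zero r (\<lambda>z. fps_nth (log_factor (\<alpha> * monomial z m) d) l)"
proof -
  define J where "J = {j. j > 0 \<and> j * d = l}"
  define z0 where "z0 = polar_point r 0"
  have z0: "z0 \<in> torus r"
    unfolding z0_def by (rule polar_point_in_torus) (rule r)
  have norm_term: "norm (log_term (\<alpha> * monomial z m) j) = norm (log_term (\<alpha> * monomial z0 m) j)"
    if "z \<in> torus r" for z j
    using that z0 by (simp add: log_term_def norm_mult norm_divide norm_power norm_monomial torus_def)
  have summable: "(\<lambda>j. norm (log_term (\<alpha> * monomial z0 m) j)) summable_on J"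
    using conv[OF z0] by (auto simp: log_factor_converges_def J_def summable_on_iff_abs_summable_on_complex)
  \<comment> \<open>The case \<open>j = 0\<close>, where division by zero makes the term vanish, is included because the
    limit below is along the filter of finite subsets of \<open>J\<close>, while the rule for uniform
    limits asks for mean zero along all index sets.\<close>
  have terms: "mean_zero r (\<lambda>z. log_term (\<alpha> * monomial z m) j)" for j
  proof (cases "j = 0")
    case True
    then show ?thesis
      by (simp add: log_term_def mean_zero_0)
  next
    case False
    then have "(\<chi> k. int j * m $ k) \<noteq> 0"
      using m by (auto simp: vec_eq_iff)
    then have "mean_zero r (\<lambda>z. ((- 1) ^ (j - 1) / of_nat j * \<alpha> ^ j) * monomial z (\<chi> k. int j * m $ k))"
      by (intro mean_zero_cmult mean_zero_monomial r)
    then show ?thesis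
      by (simp add: log_term_def power_mult_distrib monomial_power mult.assoc)
  qed
  have "mean_zero r (\<lambda>z. \<Sum>\<^sub>\<infinity>j\<in>J. log_term (\<alpha> * monomial z m) j)"
  proof (rule mean_zero_uniform_limit[OF r])
    show "uniform_limit (torus r) (\<lambda>K z. \<Sum>j\<in>K. log_term (\<alpha> * monomial z m) j)
        (\<lambda>z. \<Sum>\<^sub>\<infinity>j\<in>J. log_term (\<alpha> * monomial z m) j) (finite_subsets_at_top J)"
      by (rule Weierstrass_m_test_general[OF _ summable]) (simp add: norm_term)
    show "mean_zero r (\<lambda>z. \<Sum>j\<in>K. log_term (\<alpha> * monomial z m) j)" for K
      by (intro mean_zero_sum terms)
  qed simp
  then show ?thesis
    by (simp add: log_factor_def J_def)
qed

lemma vector_derivative_circlepath_0: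
  "vector_derivative (circlepath 0 r) (at t) = 2 * of_real pi * \<i> * circlepath 0 r t"
  by (simp add: vector_derivative_circlepath) (simp add: circlepath)

text \<open>Positive radii are determined by the torus, as it contains a point and all its points have the
  same absolute values.\<close>

lemma torus_radii_torus:
  fixes r :: "real ^ 'k"
  assumes r: "\<And>k. r $ k > 0"
  shows "torus_radii (torus r) = r"
  unfolding torus_radii_def
proof (rule the_equality)
  show "(\<forall>k. 0 < r $ k) \<and> torus r = {z. \<forall>k. cmod (z $ k) = r $ k}"
    using r by (simp add: torus_def)
next
  fix r' :: "real ^ 'k"
  assume "(\<forall>k. 0 < r' $ k) \<and> torus r = {z. \<forall>k. cmod (z $ k) = r' $ k}"
  moreover have p: "polar_point r 0 \<in> torus r"
    by (rule polar_point_in_torus) (rule r)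
  ultimately have "cmod (polar_point r 0 $ k) = r' $ k" for k
    by simp
  with p show "r' = r"
    by (simp add: torus_def vec_eq_iff)
qed

text \<open>The factor \<open>2\<pi>\<i>z\<^sub>k\<close> coming from the derivative of each circle path cancels the denominator up to a
  constant, which turns the integral into a multiple of the mean value of \<open>F\<close>.\<close>

lemma torus_integral_eq_0:
  fixes r :: "real ^ 'k"
  assumes r: "\<And>k. r $ k > 0" and F: "mean_zero r F"
  shows "torus_integral (torus r) (\<lambda>z. F z / (\<Prod>k\<in>UNIV. z $ k)) = 0"
proof -
  have jacobian: "F (polar_point r \<theta>) / (\<Prod>k\<in>UNIV. polar_point r \<theta> $ k) *
      (\<Prod>k\<in>UNIV. vector_derivative (circlepath 0 (r $ k)) (at (\<theta> $ k))) =
      (2 * of_real pi * \<i>) ^ CARD('k) * F (polar_point r \<theta>)" for \<theta>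
  proof -
    have "polar_point r \<theta> $ k \<noteq> 0" for k
      using r[of k] by (simp add: polar_point_def circlepath)
    then have "(\<Prod>k\<in>UNIV. polar_point r \<theta> $ k) \<noteq> 0"
      by simp
    moreover have "(\<Prod>k\<in>UNIV. vector_derivative (circlepath 0 (r $ k)) (at (\<theta> $ k))) =
        (2 * of_real pi * \<i>) ^ CARD('k) * (\<Prod>k\<in>UNIV. polar_point r \<theta> $ k)"
      by (simp add: vector_derivative_circlepath_0 prod.distrib polar_point_def)
    ultimately show ?thesis
      by simp
  qed
  have "((\<lambda>\<theta>. (2 * of_real pi * \<i>) ^ CARD('k) * F (polar_point r \<theta>)) has_integral 0) (cbox 0 1)"
    using mean_zero_cmult[OF F] by (simp add: mean_zero_def)
  then show ?thesis
    unfolding torus_integral_def torus_radii_torus[OF r] polar_point_def[symmetric] jacobian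
    by (rule integral_unique)
qed

text \<open>The expansion is integrated factor by factor. It represents the branch \<open>lg\<close> itself, not merely up to
  multiples of \<open>2\<pi>\<i>\<close>, so that the constant coefficient vanishes too.\<close>

lemma complex_ronkin_eq_0:
  fixes r :: "real ^ 'k" and m :: "nat \<Rightarrow> int ^ 'k"
  assumes r: "\<And>k. r $ k > 0" and U: "torus r \<subseteq> U" and m: "\<And>i. i \<ge> 1 \<Longrightarrow> m i \<noteq> 0"
    and expansion: "convergent_product_expansion U g lg (\<lambda>i z. \<alpha> i * monomial z (m i)) d"
  shows "complex_ronkin (torus r) g lg = 0"
proof (rule fps_ext)
  fix l
  have "mean_zero r (\<lambda>z. fps_nth (log_series (lg z) (g z)) l)"
  proof (rule mean_zero_uniform_limit[OF r])
    show "uniform_limit (torus r)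
        (\<lambda>N z. fps_nth (\<Sum>i=1..N. log_factor (\<alpha> i * monomial z (m i)) (d i)) l)
        (\<lambda>z. fps_nth (log_series (lg z) (g z)) l) sequentially"
      using expansion U compact_torus[of r]
      unfolding convergent_product_expansion_def locally_uniform_limit_def by blast
    show "mean_zero r (\<lambda>z. fps_nth (\<Sum>i=1..N. log_factor (\<alpha> i * monomial z (m i)) (d i)) l)" for N
      unfolding fps_sum_nth
    proof (intro mean_zero_sum mean_zero_log_factor r m)
      fix i z assume "i \<in> {1..N}" "z \<in> torus r"
      then show "log_factor_converges (\<alpha> i * monomial z (m i)) (d i)"
        using expansion U by (auto simp: convergent_product_expansion_def)
    qed simp
  qed simp
  from torus_integral_eq_0[OF r this] show "fps_nth (complex_ronkin (torus r) g lg) l = fps_nth 0 l"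
    by (simp add: complex_ronkin_def)
qed

section \<open>Fibres of the momentum map over interior points\<close>

definition log_abs :: "complex ^ 'k \<Rightarrow> real ^ 'k" where
  "log_abs z = (\<chi> k. ln (cmod (z $ k)))"

lemma ln_power_int: "x > 0 \<Longrightarrow> ln (x powi n) = of_int n * ln (x::real)"
  by (auto simp: power_int_def ln_realpow ln_inverse)

lemma ln_norm_monomial: "z \<in> big_torus \<Longrightarrow> ln (norm (monomial z m)) = real_vec m \<bullet> log_abs z"
  by (simp add: norm_monomial big_torus_def ln_prod ln_power_int log_abs_def real_vec_def inner_vec_def)

text \<open>Dividing by \<open>h\<close>, the linear form given by \<open>s\<close> takes the value \<open>C\<close> at all rational points of \<open>\<rho>\<close>.
  Near an interior point of \<open>\<rho>\<close> there are, for a large denominator \<open>N\<close>, points of \<open>(1/N) \<int>\<^sup>k\<close> that stay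
  in \<open>\<rho>\<close> after a step of length \<open>1/N\<close> in any coordinate direction. Comparing the two values shows
  that the coordinates of \<open>s\<close> vanish.\<close>

lemma cone_points_separate:
  fixes s :: "real ^ 'k"
  assumes "interior \<rho> \<noteq> {}"
    and zero: "\<And>m h. (m, h) \<in> cone_points \<rho> \<Longrightarrow> real_vec m \<bullet> s = real h * C"
  shows "s = 0"
proof -
  obtain x e where e: "e > 0" "ball x e \<subseteq> \<rho>"
    using assms(1) mem_interior by blast
  obtain N :: nat where N: "real N > 2 * real CARD('k) / e"
    using reals_Archimedean2 by blast
  then have Npos: "real N > 0"
    using e(1) by (smt (verit) divide_nonneg_pos of_nat_0_le_iff)
  \<comment> \<open>The bound 2 covers the rounding error 1 together with a step by 1 in a coordinate
    direction.\<close>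
  have in_cone: "(m, N) \<in> cone_points \<rho>" if m: "\<And>k. \<bar>real_of_int (m $ k) - real N * x $ k\<bar> \<le> 2" for m
  proof -
    have "norm ((1 / real N) *\<^sub>R real_vec m - x) \<le> (\<Sum>k\<in>UNIV. \<bar>((1 / real N) *\<^sub>R real_vec m - x) $ k\<bar>)"
      by (rule norm_le_l1_cart)
    also have "\<dots> \<le> (\<Sum>k\<in>(UNIV :: 'k set). 2 / real N)"
    proof (rule sum_mono)
      fix k
      have "((1 / real N) *\<^sub>R real_vec m - x) $ k = (real_of_int (m $ k) - real N * x $ k) / real N"
        using Npos by (simp add: real_vec_def field_simps)
      then show "\<bar>((1 / real N) *\<^sub>R real_vec m - x) $ k\<bar> \<le> 2 / real N"
        using m[of k] Npos by (simp add: divide_right_mono)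
    qed
    also have "\<dots> < e"
      using N Npos e(1) by (simp add: field_simps)
    finally have "(1 / real N) *\<^sub>R real_vec m \<in> ball x e"
      by (simp add: dist_norm norm_minus_commute)
    with e(2) Npos show ?thesis
      by (auto simp: cone_points_def)
  qed
  define m0 :: "int ^ 'k" where "m0 = (\<chi> k. \<lfloor>real N * x $ k\<rfloor>)"
  have "s $ k = 0" for k
  proof -
    have "real_vec m0 \<bullet> s = real N * C"
      by (intro zero in_cone) (simp add: m0_def, linarith)
    moreover have "real_vec (m0 + axis k 1) \<bullet> s = real N * C"
      by (intro zero in_cone) (simp add: m0_def axis_def, linarith)
    moreover have "real_vec (m0 + axis k 1) = real_vec m0 + axis k 1"
      by (simp add: real_vec_def vec_eq_iff axis_def)
    ultimately show ?thesis
      by (simp add: inner_add_left inner_axis')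
  qed
  then show ?thesis
    by (simp add: vec_eq_iff)
qed

text \<open>The values of a monoid homomorphism that vanishes nowhere on the cone show that the cone is closed
  under addition, contains 0 and has points of positive degree. In turn these properties
  make the function \<open>(m, h) \<mapsto> w\<^sup>m\<close> on the cone a point of the toric variety.\<close>

lemma torus_point_homogeneous:
  assumes \<phi>: "torus_act c z (torus_point \<rho> 1) \<in> homogeneous_points \<rho>"
    and c: "c \<noteq> 0" and z: "z \<in> big_torus" and w: "w \<in> big_torus"
  shows "torus_point \<rho> w \<in> homogeneous_points \<rho>"
proof -
  let ?\<phi> = "torus_act c z (torus_point \<rho> 1)"
  have nz: "?\<phi> (m, h) \<noteq> 0 \<longleftrightarrow> (m, h) \<in> cone_points \<rho>" for m h
    using c monomial_nonzero[OF z] by (simp add: torus_act_def torus_point_def monomial_1)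
  have "?\<phi> (0, 0) = 1"
    using \<phi> by (simp add: homogeneous_points_def)
  then have cone0: "(0, 0) \<in> cone_points \<rho>"
    using nz[of 0 0] by simp
  have cone_add: "(m + m', h + h') \<in> cone_points \<rho>"
    if "(m, h) \<in> cone_points \<rho>" "(m', h') \<in> cone_points \<rho>" for m m' h h'
  proof -
    have "?\<phi> (m + m', h + h') = ?\<phi> (m, h) * ?\<phi> (m', h')"
      using \<phi> that unfolding homogeneous_points_def by blast
    then show ?thesis
      using that nz by (metis mult_eq_0_iff)
  qed
  have "\<exists>(m, h)\<in>cone_points \<rho>. h > 0"
    using \<phi> unfolding homogeneous_points_def by blast
  then show ?thesis
    using cone0 cone_add monomial_nonzero[OF w]
    by (auto simp: homogeneous_points_def torus_point_def monomial_0 monomial_add[OF w])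
qed

text \<open>A point over \<open>x\<close> exists because the momentum map is surjective, and it lies in the big torus because
  \<open>x\<close> is an interior point. Its fibre consists of the points \<open>u z\<close> with \<open>|u\<^sub>k| = 1\<close>, but in homogeneous
  coordinates these are only given up to a factor \<open>c\<^sup>h\<close>. Such a factor cannot change the absolute
  values of the toric coordinates: by \<open>cone_points_separate\<close> it would shift their logarithms by a
  vector whose inner product with the rational points of \<open>\<rho>\<close> is constant, and only zero is such.\<close>

lemma momentum_fibre_torus:
  fixes \<rho> :: "(real ^ 'k) set"
  assumes \<mu>: "momentum_map \<rho> \<mu>" and x: "x \<in> interior \<rho>"
  obtains r :: "real ^ 'k" where "\<And>k. r $ k > 0" "momentum_fibre \<rho> \<mu> x = torus r"
proof -
  have fibres: "\<mu> \<phi> = \<mu> \<psi> \<longleftrightarrow> (\<exists>c u. c \<noteq> 0 \<and> (\<forall>k. cmod (u $ k) = 1) \<and> \<psi> = torus_act c u \<phi>)"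
    if "\<phi> \<in> homogeneous_points \<rho>" "\<psi> \<in> homogeneous_points \<rho>" for \<phi> \<psi>
    using \<mu> that by (simp add: momentum_map_def)
  have "x \<in> \<mu> ` homogeneous_points \<rho>"
    using \<mu> x interior_subset by (auto simp: momentum_map_def)
  then obtain \<phi> where \<phi>: "\<phi> \<in> homogeneous_points \<rho>" "\<mu> \<phi> = x"
    by blast
  obtain c z where c: "c \<noteq> 0" and z: "z \<in> big_torus" and \<phi>_eq: "\<phi> = torus_act c z (torus_point \<rho> 1)"
    using \<mu> \<phi> x unfolding momentum_map_def by blast
  have hom: "torus_point \<rho> w \<in> homogeneous_points \<rho>" if "w \<in> big_torus" for w
    using torus_point_homogeneous \<phi>(1) c z that unfolding \<phi>_eq by blast
  have "\<phi> = torus_act c 1 (torus_point \<rho> z)"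
    by (auto simp: \<phi>_eq torus_act_def torus_point_def monomial_1)
  then have \<mu>z: "\<mu> (torus_point \<rho> z) = x"
    using fibres[OF hom[OF z] \<phi>(1)] c \<phi>(2) by (metis norm_one one_index)
  define r :: "real ^ 'k" where "r = (\<chi> k. cmod (z $ k))"
  have r: "r $ k > 0" for k
    using z by (simp add: r_def big_torus_def)
  have fibre: "\<mu> (torus_point \<rho> w) = x \<longleftrightarrow> w \<in> torus r" if w: "w \<in> big_torus" for w
  proof
    assume "w \<in> torus r"
    define u :: "complex ^ 'k" where "u = (\<chi> k. w $ k / z $ k)"
    have "cmod (u $ k) = 1" for k
      using \<open>w \<in> torus r\<close> r[of k] by (simp add: u_def torus_def r_def norm_divide)
    moreover have "w $ k = u $ k * z $ k" for k
      using z by (simp add: u_def big_torus_def)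
    then have "monomial w m = monomial u m * monomial z m" for m
      by (simp add: monomial_def power_int_mult_distrib prod.distrib)
    then have "torus_point \<rho> w = torus_act 1 u (torus_point \<rho> z)"
      by (auto simp: torus_point_def torus_act_def)
    ultimately show "\<mu> (torus_point \<rho> w) = x"
      using fibres[OF hom[OF z] hom[OF w]] \<mu>z by (metis one_neq_zero)
  next
    assume "\<mu> (torus_point \<rho> w) = x"
    then obtain b :: complex and u :: "complex ^ 'k" where b: "b \<noteq> 0" and u: "\<And>k. cmod (u $ k) = 1"
      and eq: "torus_point \<rho> w = torus_act b u (torus_point \<rho> z)"
      using fibres[OF hom[OF z] hom[OF w]] \<mu>z by auto
    have "real_vec m \<bullet> (log_abs w - log_abs z) = real h * ln (cmod b)" if mh: "(m, h) \<in> cone_points \<rho>" for m h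
    proof -
      have "monomial w m = b ^ h * monomial u m * monomial z m"
        using fun_cong[OF eq, of "(m, h)"] mh by (simp add: torus_point_def torus_act_def)
      then have "norm (monomial w m) = cmod b ^ h * norm (monomial z m)"
        using u by (simp add: norm_mult norm_power norm_monomial[of u])
      then have "ln (norm (monomial w m)) = real h * ln (cmod b) + ln (norm (monomial z m))"
        using b monomial_nonzero[OF z] by (simp add: ln_mult_pos ln_realpow)
      then show ?thesis
        by (simp add: ln_norm_monomial z w inner_diff_right)
    qed
    then have "log_abs w - log_abs z = 0"
      using cone_points_separate x by blast
    then have "ln (cmod (w $ k)) = ln (cmod (z $ k))" for k
      by (simp add: log_abs_def vec_eq_iff)
    then show "w \<in> torus r"
      using z w by (simp add: torus_def r_def big_torus_def)
  qed
  have "momentum_fibre \<rho> \<mu> x = torus r"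
    using fibre torus_subset_big_torus[OF r] by (auto simp: momentum_fibre_def)
  with r that show ?thesis
    by blast
qed

section \<open>Vanishing of the Ronkin function\<close>

theorem proposition1p6:
  fixes \<iota> :: "complex \<Rightarrow> 'a::comm_ring_1" and ev :: "'a \<Rightarrow> complex"
    and \<rho> \<bb> :: "(real ^ 'k) set"
    and \<mu> :: "((int ^ 'k) \<times> nat \<Rightarrow> complex) \<Rightarrow> real ^ 'k"
    and x :: "real ^ 'k"
    and f :: "((int ^ 'k) \<Rightarrow>\<^sub>0 'a) poly"
    and a :: "nat \<Rightarrow> 'a" and m :: "nat \<Rightarrow> int ^ 'k" and d :: "nat \<Rightarrow> nat"
    and U :: "(complex ^ 'k) set" and lg :: "complex ^ 'k \<Rightarrow> complex"
  assumes algebra: "finitely_generated_algebra \<iota>" "analytic_point \<iota> ev"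
    and polyhedron: "integral_polyhedron \<rho>" "interior \<rho> \<noteq> {}"
    and momentum: "momentum_map \<rho> \<mu>"
    and slab: "rational_polyhedron \<bb>" "\<bb> \<subseteq> \<rho>" "x \<in> interior \<bb>"
    and no_zeros: "\<forall>z\<in>momentum_fibre \<rho> \<mu> x. laurent_eval ev (poly.coeff f 0) z \<noteq> 0"
    and neighbourhood: "open U" "momentum_fibre \<rho> \<mu> x \<subseteq> U" "U \<subseteq> big_torus"
    and nonzero: "\<forall>i\<ge>1. m i \<noteq> 0"
    and expansion: "convergent_product_expansion U
        (twisted_slab_function ev f (slab_order ev f (momentum_fibre \<rho> \<mu> x))) lg
        (\<lambda>i z. ev (a i) * monomial z (m i)) d"
  shows "complex_ronkin (momentum_fibre \<rho> \<mu> x)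
      (twisted_slab_function ev f (slab_order ev f (momentum_fibre \<rho> \<mu> x))) lg = 0"
proof -
  have "x \<in> interior \<rho>"
    using slab interior_mono by blast
  then obtain r :: "real ^ 'k" where r: "\<And>k. r $ k > 0" and fibre: "momentum_fibre \<rho> \<mu> x = torus r"
    using momentum_fibre_torus[OF momentum] by blast
  show ?thesis
    using complex_ronkin_eq_0[OF r _ _ expansion] neighbourhood(2) nonzero unfolding fibre by blast
qed

end
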